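(* Fix integers $m\ge1$ and $n\ge 2$, and consider $n$-run order-of-addition (OofA) designs with $m$ components and no replicated runs. Let $D^*$ be a maximin Kendall tau distance design, and write $k^*=k_{\min}(D^* )$. Suppose that, among all designs attaining the maximum value $k^*$ of $k_{\min}$, $D^*$ has the smallest number of pairs at distance $k^*$, that is, $\nu_{k^*}(D^* )$ is minimal among all maximin Kendall tau distance designs. Then, under the Gaussian process model with the Mallows kernel, $D^*$ is asymptotically D-optimal as $\theta\to\infty$, in the following precise sense: for any competing $n$-run design $D$ with no replicated runs satisfying either $$k_{\min}(D)<k^*,$$ or $$k_{\min}(D)=k^*\quad\text{and}\quad \nu_{k^*}(D)>\nu_{k^*}(D^* ),$$ we have $$\det\{\Sigma_{D^*}(\theta)\}>\det\{\Sigma_D(\theta)\}$$ for all sufficiently large $\theta$.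
   Context: Let $\mathcal{Z}_m=\{0,1,\ldots,m-1\}$ and let $\mathcal{S}_m$ be the set of all permutations (orderings) of $\mathcal{Z}_m$. An $n$-run OofA design with $m$ components is a list $D=\{x_1,\ldots,x_n\}$ of $n$ elements of $\mathcal{S}_m$, called runs; it has no replicated runs if the $x_i$ are pairwise distinct. For $x\in\mathcal{S}_m$ and $c\in\mathcal{Z}_m$, $\pi_x(c)$ denotes the position of $c$ in $x$. Kendall tau distance: $k(x,y)=\#\{(a,b):0\le a<b\le m-1,\ (\pi_x(a)-\pi_x(b))(\pi_y(a)-\pi_y(b))<0\}$. Put $k_{\min}(D)=\min_{1\le i<j\le n}k(x_i,x_j)$. A maximin Kendall tau distance design is an $n$-run OofA design with $m$ components that maximizes $k_{\min}$ among all such designs. For $r=0,\ldots,\binom m2$, $\nu_r(D)=\#\{(i,j):1\le i<j\le n,\ k(x_i,x_j)=r\}$. Gaussian process model with the Mallows kernel: $Y(x)=\mu+Z(x)$ with $\mu$ an unknown constant and $Z$ a zero-mean Gaussian process on $\mathcal{S}_m$ with $\operatorname{cov}\{Z(x),Z(y)\}=\sigma^2K(x,y;\theta)$, where $K(x,y;\theta)=\exp\{-\theta\,k(x,y)\}$, $\theta>0$. For $D=\{x_1,\ldots,x_n\}$, $\Sigma_D(\theta)$ is the $n\times n$ matrix with $(i,j)$ entry $K(x_i,x_j;\theta)$. The D-optimality criterion considered is maximization of $\det\{\Sigma_D(\theta)\}$. *)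

theory Defs
  imports
    Complex_Main
    "HOL-Combinatorics.Multiset_Permutations"
    "Jordan_Normal_Form.Determinant"
begin

text \<open>
  A run with \<open>m\<close> components is an ordering of \<open>{..<m}\<close>, represented as a list. A design is a list
  of runs; it has no replicated runs iff that list is \<^const>\<open>distinct\<close>.
\<close>

definition runs :: "nat \<Rightarrow> nat list set" where
  "runs m = permutations_of_set {..<m}"

definition oofa_design :: "nat \<Rightarrow> nat \<Rightarrow> nat list list \<Rightarrow> bool" where
  "oofa_design m n D \<longleftrightarrow> length D = n \<and> set D \<subseteq> runs m"

text \<open>
  Positions are counted from 0; only differences of positions matter below. The description is
  meaningful for \<open>x \<in> runs m\<close> and \<open>c < m\<close>. It is integer valued so that differences do not truncate.
\<close>

definition position :: "nat list \<Rightarrow> nat \<Rightarrow> int" where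
  "position x c = int (THE i. i < length x \<and> x ! i = c)"

definition kendall_tau :: "nat \<Rightarrow> nat list \<Rightarrow> nat list \<Rightarrow> nat" where
  "kendall_tau m x y =
     card {(a, b). a < b \<and> b < m \<and>
                   (position x a - position x b) * (position y a - position y b) < 0}"

text \<open>The minimum is over a nonempty set only for designs with at least two runs.\<close>

definition k_min :: "nat \<Rightarrow> nat list list \<Rightarrow> nat" where
  "k_min m D = Min {kendall_tau m (D ! i) (D ! j) | i j. i < j \<and> j < length D}"

definition \<nu> :: "nat \<Rightarrow> nat \<Rightarrow> nat list list \<Rightarrow> nat" where
  "\<nu> m r D = card {(i, j). i < j \<and> j < length D \<and> kendall_tau m (D ! i) (D ! j) = r}"

text \<open>The comparison is with all \<open>n\<close>-run designs, including those with replicated runs.\<close>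

definition maximin_design :: "nat \<Rightarrow> nat \<Rightarrow> nat list list \<Rightarrow> bool" where
  "maximin_design m n D \<longleftrightarrow>
     oofa_design m n D \<and> (\<forall>D'. oofa_design m n D' \<longrightarrow> k_min m D' \<le> k_min m D)"

definition mallows_kernel :: "nat \<Rightarrow> real \<Rightarrow> nat list \<Rightarrow> nat list \<Rightarrow> real" where
  "mallows_kernel m \<theta> x y = exp (- \<theta> * real (kendall_tau m x y))"

text \<open>
  For a Gaussian process whose covariance is \<open>\<sigma>\<^sup>2\<close> times the Mallows kernel, this is the
  correlation matrix of the responses at the runs of \<open>D\<close>.
\<close>

definition corr_matrix :: "nat \<Rightarrow> nat list list \<Rightarrow> real \<Rightarrow> real mat" where
  "corr_matrix m D \<theta> =
     mat (length D) (length D) (\<lambda>(i, j). mallows_kernel m \<theta> (D ! i) (D ! j))"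

end

theory Submission
  imports Defs "HOL-Real_Asymp.Real_Asymp"
begin

text \<open>
  With \<open>q = exp (-\<theta>)\<close>, the Leibniz formula writes the determinant as the sum over permutations
  \<open>p\<close> of the indices of \<open>sign p * q ^ (\<Sum>i. k(x\<^sub>i, x\<^bsub>p i\<^esub>))\<close>. If all distances between different
  runs are at least \<open>k \<ge> 1\<close>, a non-identity \<open>p\<close> has exponent at least \<open>2k\<close>, with equality only
  for transpositions of two runs at distance exactly \<open>k\<close>. Hence
  \<open>det = 1 - \<nu>\<^sub>k q ^ (2k) + o(q ^ (2k))\<close>, and both designs are compared at \<open>k = k_min D\<close>:
  if \<open>k_min D < k_min D*\<close> then \<open>\<nu>\<^sub>k(D*) = 0 < \<nu>\<^sub>k(D)\<close>.
\<close>

section \<open>Kendall tau distance: symmetry, zero diagonal, separation of runs\<close>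

lemma position_nth:
  assumes "distinct x" "i < length x"
  shows "position x (x ! i) = int i"
proof -
  have "(THE j. j < length x \<and> x ! j = x ! i) = i"
    using assms by (auto simp: nth_eq_iff_index_eq)
  then show ?thesis by (simp add: position_def)
qed

lemma inj_on_position:
  assumes "distinct x"
  shows "inj_on (position x) (set x)"
  by (rule inj_onI) (metis assms in_set_conv_nth of_nat_eq_iff position_nth)

lemma kendall_tau_commute: "kendall_tau m x y = kendall_tau m y x"
  by (simp add: kendall_tau_def mult.commute)

lemma kendall_tau_self: "kendall_tau m x x = 0"
proof -
  have "\<not> (position x a - position x b) * (position x a - position x b) < 0" for a b
    by (simp add: not_less)
  then show ?thesis by (simp add: kendall_tau_def)
qed

text \<open>At distance zero no pair is discordant, so the key \<open>position x\<close> increases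
  along \<open>y\<close> as it does along \<open>x\<close>. An injective key sorts a finite set in
  only one way, so the runs coincide.\<close>

lemma kendall_tau_pos:
  assumes x: "x \<in> runs m" and y: "y \<in> runs m" and "x \<noteq> y"
  shows "0 < kendall_tau m x y"
proof (rule ccontr)
  let ?A = "{(a, b). a < b \<and> b < m \<and>
     (position x a - position x b) * (position y a - position y b) < 0}"
  assume "\<not> 0 < kendall_tau m x y"
  moreover have "finite ?A"
    by (rule finite_subset[of _ "{..<m} \<times> {..<m}"]) auto
  ultimately have "?A = {}"
    by (simp add: kendall_tau_def)
  then have conc: "(position x a - position x b) * (position y a - position y b) \<ge> 0"
    if "a < b" "b < m" for a b
    using that by (auto simp: not_less[symmetric])
  \<comment> \<open>The distance inspects only pairs with \<open>a < b\<close>. Swapping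
    \<open>a\<close> and \<open>b\<close> leaves the product unchanged and \<open>a = b\<close>
    makes it zero, so the bound extends to all pairs.\<close>
  have conc: "(position x a - position x b) * (position y a - position y b) \<ge> 0"
    if "a < m" "b < m" for a b
  proof -
    consider "a < b" | "a = b" | "b < a" by linarith
    then show ?thesis
    proof cases
      case 3
      have "(position x a - position x b) * (position y a - position y b)
          = (position x b - position x a) * (position y b - position y a)"
        by (simp add: algebra_simps)
      then show ?thesis using conc[of b a] 3 that by simp
    qed (use conc that in auto)
  qed
  have dx: "distinct x" "set x = {..<m}" and dy: "distinct y" "set y = {..<m}"
    using x y by (auto simp: runs_def permutations_of_set_def)
  have "sorted (map (position x) x)"
    using dx by (auto simp: sorted_iff_nth_mono position_nth)
  moreover have "sorted (map (position x) y)"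
  proof (clarsimp simp: sorted_iff_nth_mono_less)
    fix i j assume ij: "i < j" "j < length y"
    have "y ! i < m" "y ! j < m"
      using ij dy nth_mem[of i y] nth_mem[of j y] by auto
    \<comment> \<open>Along \<open>y\<close>, \<open>position y\<close> is the index itself, so the
      second factor is negative and the first must be nonpositive.\<close>
    from conc[OF this] have "(position x (y ! i) - position x (y ! j)) * (int i - int j) \<ge> 0"
      using ij dy by (simp add: position_nth)
    then show "position x (y ! i) \<le> position x (y ! j)"
      using ij by (auto simp: zero_le_mult_iff)
  qed
  ultimately have "x = y"
    using dx dy inj_on_position[of x]
    by (intro map_sorted_distinct_set_unique[of "position x"]) (auto simp: distinct_map)
  with \<open>x \<noteq> y\<close> show False by simp
qed

section \<open>Exponents of permutations and the Leibniz expansion of the determinant\<close>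

lemma permutes_transpose_sum:
  fixes \<kappa> :: "'a \<Rightarrow> 'a \<Rightarrow> nat"
  assumes "finite A" "i \<in> A" "j \<in> A" "i \<noteq> j" and diag: "\<And>i. i \<in> A \<Longrightarrow> \<kappa> i i = 0"
  shows "(\<Sum>l\<in>A. \<kappa> l (transpose i j l)) = \<kappa> i j + \<kappa> j i"
proof -
  have "(\<Sum>l\<in>A. \<kappa> l (transpose i j l)) = (\<Sum>l\<in>{i, j}. \<kappa> l (transpose i j l))"
    using assms by (intro sum.mono_neutral_right) (auto simp: transpose_def)
  then show ?thesis using \<open>i \<noteq> j\<close> by simp
qed

text \<open>A non-identity \<open>p\<close> moves some \<open>i\<close> and, by injectivity, also
  \<open>p i\<close>; each costs at least \<open>k\<close>. Equality leaves nothing for the other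
  points, and since \<open>k\<close> is positive they are all fixed.\<close>

lemma permutes_sum_ge:
  fixes \<kappa> :: "'a \<Rightarrow> 'a \<Rightarrow> nat"
  assumes "finite A" and p: "p permutes A" "p \<noteq> id" and "0 < k"
    and sep: "\<And>i j. i \<in> A \<Longrightarrow> j \<in> A \<Longrightarrow> i \<noteq> j \<Longrightarrow> k \<le> \<kappa> i j"
  shows "2 * k \<le> (\<Sum>l\<in>A. \<kappa> l (p l))"
    and "(\<Sum>l\<in>A. \<kappa> l (p l)) = 2 * k \<Longrightarrow>
      \<exists>i\<in>A. \<exists>j\<in>A. i \<noteq> j \<and> p = transpose i j \<and> \<kappa> i j = k"
proof -
  obtain i where i: "p i \<noteq> i" using p(2) by (auto simp: fun_eq_iff)
  have iA: "i \<in> A" using i p(1) by (metis permutes_not_in)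
  define j where "j = p i"
  have jA: "j \<in> A" using iA p(1) by (simp add: j_def permutes_in_image)
  have pj: "p j \<noteq> j" using i permutes_inj[OF p(1)] by (auto simp: j_def dest: injD)
  have pA: "p l \<in> A" if "l \<in> A" for l using that p(1) by (simp add: permutes_in_image)
  have ij: "i \<noteq> j" using i by (simp add: j_def)
  have "(\<Sum>l\<in>A. \<kappa> l (p l)) = (\<Sum>l\<in>A - {i, j}. \<kappa> l (p l)) + (\<Sum>l\<in>{i, j}. \<kappa> l (p l))"
    using iA jA \<open>finite A\<close> by (intro sum.subset_diff) auto
  then have split: "(\<Sum>l\<in>A. \<kappa> l (p l)) = (\<Sum>l\<in>A - {i, j}. \<kappa> l (p l)) + \<kappa> i j + \<kappa> j (p j)"
    using ij by (simp add: j_def[symmetric])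
  have ge: "k \<le> \<kappa> i j" "k \<le> \<kappa> j (p j)"
    using sep[OF iA jA ij] sep[OF jA pA[OF jA]] pj by auto
  show "2 * k \<le> (\<Sum>l\<in>A. \<kappa> l (p l))" using split ge by linarith
  assume "(\<Sum>l\<in>A. \<kappa> l (p l)) = 2 * k"
  then have eq: "\<kappa> i j = k" and "(\<Sum>l\<in>A - {i, j}. \<kappa> l (p l)) = 0"
    using split ge by linarith+
  then have zero: "\<kappa> l (p l) = 0" if "l \<in> A - {i, j}" for l
    using that \<open>finite A\<close> by simp
  have fixed: "p l = l" if "l \<noteq> i" "l \<noteq> j" for l
  proof (cases "l \<in> A")
    case True
    then show ?thesis using zero[of l] sep[of l "p l"] pA[of l] \<open>0 < k\<close> that by fastforce
  qed (use p(1) in \<open>simp add: permutes_not_in\<close>)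
  \<comment> \<open>Otherwise \<open>p j\<close> would be a fixed point, and injectivity would give
    \<open>p j = j\<close>, against \<open>pj\<close>.\<close>
  have "p j = i"
    using fixed[of "p j"] pj permutes_inj[OF p(1)] by (metis injD)
  then have "p = transpose i j"
    using fixed by (auto simp: fun_eq_iff transpose_def j_def)
  with eq ij iA jA show "\<exists>i\<in>A. \<exists>j\<in>A. i \<noteq> j \<and> p = transpose i j \<and> \<kappa> i j = k" by blast
qed

text \<open>The factor \<open>exp (\<theta> * real (2 * k))\<close> brings the leading correction to
  constant order. Here \<open>k\<close> is only a lower bound for the off-diagonal entries: if it is
  not attained, the limit is 0.\<close>

lemma det_exp_matrix_asymptotics:
  fixes \<kappa> :: "nat \<Rightarrow> nat \<Rightarrow> nat"
  assumes "0 < k" and sym: "\<And>i j. \<kappa> i j = \<kappa> j i" and diag: "\<And>i. \<kappa> i i = 0"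
    and sep: "\<And>i j. i < n \<Longrightarrow> j < n \<Longrightarrow> i \<noteq> j \<Longrightarrow> k \<le> \<kappa> i j"
  shows "((\<lambda>\<theta>. (det (mat n n (\<lambda>(i, j). exp (- \<theta> * real (\<kappa> i j)))) - 1) * exp (\<theta> * real (2 * k)))
     \<longlongrightarrow> - real (card {(i, j). i < j \<and> j < n \<and> \<kappa> i j = k})) at_top"
proof -
  let ?P = "{p. p permutes {0..<n}}"
  let ?Q = "?P - {id}"
  let ?E = "{(i, j). i < j \<and> j < n \<and> \<kappa> i j = k}"
  define s where "s p = (\<Sum>l\<in>{0..<n}. \<kappa> l (p l))" for p
  have finP: "finite ?P" by (simp add: finite_permutations)
  have s_ge: "2 * k \<le> s p" if "p \<in> ?Q" for p
    unfolding s_def using that \<open>0 < k\<close> sep by (intro permutes_sum_ge(1)) auto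
  \<comment> \<open>The permutations of least exponent are matched with index pairs, which turns the
    sum of leading coefficients into a count of pairs at distance \<open>k\<close>.\<close>
  have min_iff: "{p \<in> ?Q. s p = 2 * k} = (\<lambda>(i, j). transpose i j) ` ?E"
  proof (intro equalityI subsetI)
    fix p assume p: "p \<in> {p \<in> ?Q. s p = 2 * k}"
    then have "\<exists>i\<in>{0..<n}. \<exists>j\<in>{0..<n}. i \<noteq> j \<and> p = transpose i j \<and> \<kappa> i j = k"
      unfolding s_def using \<open>0 < k\<close> sep by (intro permutes_sum_ge(2)) auto
    then obtain i j where ij: "i < n" "j < n" "i \<noteq> j" "p = transpose i j" "\<kappa> i j = k" by auto
    show "p \<in> (\<lambda>(i, j). transpose i j) ` ?E"
    proof (cases "i < j")
      case True
      with ij show ?thesis by auto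
    next
      case False
      with ij have "(j, i) \<in> ?E" "p = transpose j i"
        by (auto simp: sym[of j i] transpose_commute)
      then show ?thesis by (intro image_eqI[of _ _ "(j, i)"]) auto
    qed
  next
    fix p assume "p \<in> (\<lambda>(i, j). transpose i j) ` ?E"
    then obtain i j where ij: "i < j" "j < n" "\<kappa> i j = k" "p = transpose i j" by auto
    have "p permutes {0..<n}" using ij by (auto intro: permutes_swap_id)
    moreover have "p \<noteq> id" using ij by (metis id_apply less_irrefl transpose_apply_first)
    moreover have "s p = 2 * k"
      using ij permutes_transpose_sum[of "{0..<n}" i j \<kappa>] diag sym[of j i] by (simp add: s_def)
    ultimately show "p \<in> {p \<in> ?Q. s p = 2 * k}" by simp
  qed
  \<comment> \<open>The order \<open>i < j\<close> makes the pair recoverable from its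
    transposition.\<close>
  have inj: "inj_on (\<lambda>(i, j). transpose i j) ?E"
  proof (clarsimp simp: inj_on_def)
    fix i j i' j' :: nat
    assume lt: "i < j" "i' < j'" and eq: "transpose i j = transpose i' j'"
    have "transpose i j i = j" "transpose i j j = i" by simp_all
    then show "i = i' \<and> j = j'"
      using lt unfolding eq by (auto simp: transpose_def split: if_splits)
  qed
  \<comment> \<open>The identity contributes exactly 1, by the zero diagonal. The natural
    subtraction \<open>s p - 2 * k\<close> does not truncate, by \<open>s_ge\<close>.\<close>
  have expand: "(det (mat n n (\<lambda>(i, j). exp (- \<theta> * real (\<kappa> i j)))) - 1) * exp (\<theta> * real (2 * k))
      = (\<Sum>p\<in>?Q. of_int (sign p) * exp (- \<theta> * real (s p - 2 * k)))" for \<theta> :: real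
  proof -
    have "det (mat n n (\<lambda>(i, j). exp (- \<theta> * real (\<kappa> i j))))
        = (\<Sum>p\<in>?P. of_int (sign p) * (\<Prod>i=0..<n. exp (- \<theta> * real (\<kappa> i (p i)))))"
      by (auto simp: det_def permutes_in_image intro!: sum.cong prod.cong)
    also have "\<dots> = (\<Sum>p\<in>?P. of_int (sign p) * exp (- \<theta> * real (s p)))"
      by (simp add: exp_sum[symmetric] s_def sum_distrib_left sum_negf)
    also have "\<dots> = 1 + (\<Sum>p\<in>?Q. of_int (sign p) * exp (- \<theta> * real (s p)))"
      using finP by (subst sum.remove[of _ id]) (auto simp: permutes_id s_def diag)
    finally have "(det (mat n n (\<lambda>(i, j). exp (- \<theta> * real (\<kappa> i j)))) - 1) * exp (\<theta> * real (2 * k))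
      = (\<Sum>p\<in>?Q. of_int (sign p) * (exp (- \<theta> * real (s p)) * exp (\<theta> * real (2 * k))))"
      by (simp add: sum_distrib_right mult.assoc)
    also have "\<dots> = (\<Sum>p\<in>?Q. of_int (sign p) * exp (- \<theta> * real (s p - 2 * k)))"
      using s_ge by (intro sum.cong refl) (simp add: exp_add[symmetric] of_nat_diff algebra_simps)
    finally show ?thesis .
  qed
  \<comment> \<open>At least exponent \<open>p\<close> is a transposition, so only its sign -1
    survives; every other term has a positive exponent gap and decays.\<close>
  have term_lim: "((\<lambda>\<theta>. of_int (sign p) * exp (- \<theta> * real (s p - 2 * k)))
      \<longlongrightarrow> (if s p = 2 * k then -1 else 0)) at_top" if "p \<in> ?Q" for p
  proof (cases "s p = 2 * k")
    case True
    with that have "p \<in> {p \<in> ?Q. s p = 2 * k}" by simp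
    then obtain i j where "i < j" "p = transpose i j" unfolding min_iff by auto
    then have "sign p = -1" by (simp add: sign_swap_id)
    with True show ?thesis by simp
  next
    case False
    then have "0 < real (s p - 2 * k)" using s_ge[OF that] by simp
    moreover have "((\<lambda>\<theta>. exp (- \<theta> * c)) \<longlongrightarrow> 0) at_top" if "0 < c" for c :: real
      using that by real_asymp
    ultimately have "((\<lambda>\<theta>. exp (- \<theta> * real (s p - 2 * k))) \<longlongrightarrow> 0) at_top" by blast
    then show ?thesis using False by (auto intro: tendsto_mult_right_zero)
  qed
  have "((\<lambda>\<theta>. \<Sum>p\<in>?Q. of_int (sign p) * exp (- \<theta> * real (s p - 2 * k)))
      \<longlongrightarrow> (\<Sum>p\<in>?Q. if s p = 2 * k then -1 else 0)) at_top"
    by (intro tendsto_sum term_lim)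
  also have "(\<Sum>p\<in>?Q. if s p = 2 * k then -1 else 0 :: real) = - real (card {p \<in> ?Q. s p = 2 * k})"
    using finP by (subst sum.inter_filter[symmetric]) auto
  also have "card {p \<in> ?Q. s p = 2 * k} = card ?E"
    unfolding min_iff by (rule card_image[OF inj])
  finally show ?thesis unfolding expand .
qed

section \<open>Minimum distance and pair counts of a single design\<close>

context
  fixes m n :: nat and D :: "nat list list"
  assumes D: "oofa_design m n D"
begin

lemma finite_distances: "finite {kendall_tau m (D ! i) (D ! j) | i j. i < j \<and> j < length D}"
  by (rule finite_subset[of _ "(\<lambda>(i, j). kendall_tau m (D ! i) (D ! j)) ` ({..<n} \<times> {..<n})"])
    (use D in \<open>auto simp: oofa_design_def\<close>)

lemma k_min_le:
  assumes "i < n" "j < n" "i \<noteq> j"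
  shows "k_min m D \<le> kendall_tau m (D ! i) (D ! j)"
proof -
  have *: "k_min m D \<le> kendall_tau m (D ! i) (D ! j)" if "i < j" "j < n" for i j
    unfolding k_min_def using D that
    by (intro Min_le[OF finite_distances]) (auto simp: oofa_design_def)
  from assms consider "i < j" | "j < i" by linarith
  then show ?thesis
    by cases (use * assms kendall_tau_commute in metis)+
qed

lemma k_min_attained:
  assumes "2 \<le> n"
  obtains i j where "i < j" "j < n" "kendall_tau m (D ! i) (D ! j) = k_min m D"
proof -
  \<comment> \<open>The first two runs witness that the minimum is over a nonempty set.\<close>
  have "kendall_tau m (D ! 0) (D ! 1) \<in>
      {kendall_tau m (D ! i) (D ! j) | i j. i < j \<and> j < length D}"
    using assms D by (fastforce simp: oofa_design_def)
  then have "k_min m D \<in> {kendall_tau m (D ! i) (D ! j) | i j. i < j \<and> j < length D}"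
    unfolding k_min_def by (intro Min_in[OF finite_distances]) blast
  with that D show thesis by (auto simp: oofa_design_def)
qed

text \<open>The minimum is attained at two different runs, which the distance separates; here the
  absence of replicated runs enters.\<close>

lemma k_min_pos:
  assumes "2 \<le> n" "distinct D"
  shows "0 < k_min m D"
proof -
  obtain i j where ij: "i < j" "j < n" "kendall_tau m (D ! i) (D ! j) = k_min m D"
    using k_min_attained[OF assms(1)] .
  then have "D ! i \<noteq> D ! j" "D ! i \<in> runs m" "D ! j \<in> runs m"
    using D assms(2) by (auto simp: oofa_design_def nth_eq_iff_index_eq)
  then show ?thesis using kendall_tau_pos ij(3) by metis
qed

lemma \<nu>_k_min_pos:
  assumes "2 \<le> n"
  shows "0 < \<nu> m (k_min m D) D"
proof -
  obtain i j where "i < j" "j < n" "kendall_tau m (D ! i) (D ! j) = k_min m D"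
    using k_min_attained[OF assms] .
  then have "(i, j) \<in> {(i, j). i < j \<and> j < length D \<and> kendall_tau m (D ! i) (D ! j) = k_min m D}"
    using D by (simp add: oofa_design_def)
  moreover have "finite {(i, j). i < j \<and> j < length D \<and> kendall_tau m (D ! i) (D ! j) = k_min m D}"
    by (rule finite_subset[of _ "{..<length D} \<times> {..<length D}"]) auto
  ultimately show ?thesis unfolding \<nu>_def by (auto simp: card_gt_0_iff)
qed

lemma \<nu>_below_k_min:
  assumes "k < k_min m D"
  shows "\<nu> m k D = 0"
proof -
  have "kendall_tau m (D ! i) (D ! j) \<noteq> k" if "i < j" "j < length D" for i j
    using k_min_le[of i j] that assms D by (auto simp: oofa_design_def)
  then have "{(i, j). i < j \<and> j < length D \<and> kendall_tau m (D ! i) (D ! j) = k} = {}" by auto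
  then show ?thesis by (simp only: \<nu>_def card.empty)
qed

text \<open>Leaving \<open>k\<close> free up to \<open>k_min m D\<close> allows designs with
  different minima to be compared at one common scale.\<close>

lemma det_corr_matrix_asymptotics:
  assumes "0 < k" "k \<le> k_min m D"
  shows "((\<lambda>\<theta>. (det (corr_matrix m D \<theta>) - 1) * exp (\<theta> * real (2 * k)))
     \<longlongrightarrow> - real (\<nu> m k D)) at_top"
  unfolding corr_matrix_def mallows_kernel_def \<nu>_def
proof (rule det_exp_matrix_asymptotics[OF \<open>0 < k\<close> kendall_tau_commute kendall_tau_self])
  fix i j assume "i < length D" "j < length D" "i \<noteq> j"
  then show "k \<le> kendall_tau m (D ! i) (D ! j)"
    using k_min_le[of i j] D assms(2) by (simp add: oofa_design_def)
qed

end

theorem theorem2: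
  fixes m n :: nat and Dstar :: "nat list list"
  assumes "m \<ge> 1" and "n \<ge> 2"
    and "maximin_design m n Dstar" and "distinct Dstar"
    and "\<forall>D. maximin_design m n D \<longrightarrow>
           \<nu> m (k_min m Dstar) Dstar \<le> \<nu> m (k_min m Dstar) D"
  shows "\<forall>D. oofa_design m n D \<and> distinct D \<and>
           (k_min m D < k_min m Dstar \<or>
            k_min m D = k_min m Dstar \<and>
            \<nu> m (k_min m Dstar) D > \<nu> m (k_min m Dstar) Dstar) \<longrightarrow>
           (\<forall>\<^sub>F \<theta> in at_top. det (corr_matrix m Dstar \<theta>) > det (corr_matrix m D \<theta>))"
proof (intro allI impI, elim conjE)
  fix D
  assume D: "oofa_design m n D" "distinct D"
    and worse: "k_min m D < k_min m Dstar \<or> k_min m D = k_min m Dstar \<and>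
      \<nu> m (k_min m Dstar) D > \<nu> m (k_min m Dstar) Dstar"
  \<comment> \<open>The competitor has the smaller or equal minimum, so this \<open>k\<close> is a
    lower bound for the distances in both designs.\<close>
  define k where "k = k_min m D"
  have Ds: "oofa_design m n Dstar"
    using assms(3) by (simp add: maximin_design_def)
  have k: "0 < k" "k \<le> k_min m D" "k \<le> k_min m Dstar"
    using k_min_pos[OF D(1) assms(2) D(2)] worse by (auto simp: k_def)
  \<comment> \<open>If \<open>k\<close> is strictly below the minimum of \<open>Dstar\<close>, the
    left count is zero and the right one positive; otherwise this is the assumed tie-break.\<close>
  have "\<nu> m k Dstar < \<nu> m k D"
    using worse \<nu>_k_min_pos[OF D(1) assms(2)] \<nu>_below_k_min[OF Ds, of k] by (auto simp: k_def)
  then have "- real (\<nu> m k D) < - real (\<nu> m k Dstar)" by simp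
  \<comment> \<open>The difference of the rescaled determinants tends to \<open>\<nu> m k D\<close>
    minus \<open>\<nu> m k Dstar\<close>, which is positive. The common exponential factor is
    positive and cancels afterwards.\<close>
  then have "\<forall>\<^sub>F \<theta> in at_top. (det (corr_matrix m D \<theta>) - 1) * exp (\<theta> * real (2 * k))
      < (det (corr_matrix m Dstar \<theta>) - 1) * exp (\<theta> * real (2 * k))"
    using order_tendstoD(1)[OF tendsto_diff[OF det_corr_matrix_asymptotics[OF Ds k(1,3)]
        det_corr_matrix_asymptotics[OF D(1) k(1,2)]], of 0]
    by simp
  then show "\<forall>\<^sub>F \<theta> in at_top. det (corr_matrix m Dstar \<theta>) > det (corr_matrix m D \<theta>)"
    by eventually_elim simp
qed

end
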